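(* Let $q \ge 2$ and $n \ge 1$ be integers and let $A \subset E_q^n$ be a non-empty subset. Let $k$ and $s$ be integers with $0 \le k \le n$ and $1 \le s \le p(k)$, where $p(k) = \min\{|A|, q^k\}$. Then $$\sum_{e=s}^{p(k)} \binom{e}{s} V(A,k,e) = \sum_{B \subset A,\ |B| = s} \binom{n-R(B)}{k-R(B)},$$ where the right-hand sum is over all $s$-element subsets $B$ of $A$.
   Context: $E_q = \{0,1,\dots,q-1\}$ and $E_q^n$ is the set of all $n$-dimensional vectors with coordinates in $E_q$. A $k$-dimensional face of $E_q^n$ is the set of all vectors in $E_q^n$ having prescribed fixed values in some fixed $n-k$ coordinates. The rank $R(B)$ of a non-empty subset $B \subset E_q^n$ is the dimension of the smallest face containing $B$; equivalently, it is the number of coordinates that are not constant on $B$. $V(A,k,e)$ denotes the number of $k$-dimensional faces of $E_q^n$ containing exactly $e$ elements of $A$. Convention: for integers $m \ge 0$ and $j$, $\binom{m}{j}$ is the usual binomial coefficient for $j \ge 0$, and $\binom{m}{j} = 0$ if $j < 0$. *)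

theory Defs
  imports Complex_Main "HOL-Library.FuncSet"
begin

text \<open>Coordinates are numbered \<open>0, \<dots>, n - 1\<close>. Vectors are extensional functions
  (\<open>undefined\<close> outside \<open>{..<n}\<close>), so equality of vectors is equality of coordinates.\<close>

definition qcube :: "nat \<Rightarrow> nat \<Rightarrow> (nat \<Rightarrow> nat) set" where
  "qcube q n = {..<n} \<rightarrow>\<^sub>E {..<q}"

text \<open>\<open>I\<close> is the set of the \<open>n - k\<close> fixed coordinates; only the values of \<open>c\<close> on \<open>I\<close> matter.
  The bound \<open>k \<le> n\<close> keeps \<open>n - k\<close> from truncating.\<close>

definition is_face :: "nat \<Rightarrow> nat \<Rightarrow> nat \<Rightarrow> (nat \<Rightarrow> nat) set \<Rightarrow> bool" where
  "is_face q n k F \<longleftrightarrow> k \<le> n \<and>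
     (\<exists>I c. I \<subseteq> {..<n} \<and> card I = n - k \<and> c \<in> qcube q n \<and>
            F = {x \<in> qcube q n. \<forall>i\<in>I. x i = c i})"

text \<open>Meaningful for non-empty \<open>B \<subseteq> qcube q n\<close>.\<close>

definition face_rank :: "nat \<Rightarrow> nat \<Rightarrow> (nat \<Rightarrow> nat) set \<Rightarrow> nat" where
  "face_rank q n B = (LEAST d. \<exists>F. is_face q n d F \<and> B \<subseteq> F)"

definition num_faces :: "nat \<Rightarrow> nat \<Rightarrow> (nat \<Rightarrow> nat) set \<Rightarrow> nat \<Rightarrow> nat \<Rightarrow> nat" where
  "num_faces q n A k e = card {F. is_face q n k F \<and> card (F \<inter> A) = e}"

text \<open>The lower index is an integer so that it can be negative.\<close>

definition binom :: "nat \<Rightarrow> int \<Rightarrow> nat" where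
  "binom m j = (if j < 0 then 0 else m choose nat j)"

definition varying :: "nat \<Rightarrow> (nat \<Rightarrow> nat) set \<Rightarrow> nat set" where
  "varying n B = {i. i < n \<and> (\<exists>x\<in>B. \<exists>y\<in>B. x i \<noteq> y i)}"

text \<open>The face of least dimension containing \<open>B\<close> is also the least one for inclusion, and its
  dimension is the number of coordinates that are not constant on \<open>B\<close>.\<close>

lemma face_rank_smallest:
  assumes "B \<noteq> {}" and "B \<subseteq> qcube q n"
  shows "\<exists>F. is_face q n (card (varying n B)) F \<and> B \<subseteq> F \<and>
             (\<forall>d G. is_face q n d G \<and> B \<subseteq> G \<longrightarrow> F \<subseteq> G \<and> card (varying n B) \<le> d)"
proof -
  obtain b where b: "b \<in> B" using assms(1) by blast
  define N where "N = varying n B"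
  define C where "C = {..<n} - N"
  define F where "F = {x \<in> qcube q n. \<forall>i\<in>C. x i = b i}"
  have N: "N \<subseteq> {..<n}" by (auto simp: N_def varying_def)
  have finN: "finite N" using N finite_subset by blast
  have cN: "card N \<le> n" using card_mono[OF _ N] by simp
  have cC: "card C = n - card N" using card_Diff_subset[OF finN N] by (simp add: C_def)
  have face: "is_face q n (card N) F"
    unfolding is_face_def
  proof (intro conjI exI)
    show "card N \<le> n" by (fact cN)
    show "C \<subseteq> {..<n}" by (auto simp: C_def)
    show "card C = n - card N" by (fact cC)
    show "b \<in> qcube q n" using b assms(2) by blast
    show "F = {x \<in> qcube q n. \<forall>i\<in>C. x i = b i}" by (fact F_def)
  qed
  have sub: "B \<subseteq> F" using b assms(2) by (auto simp: F_def C_def N_def varying_def)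
  have least: "F \<subseteq> G \<and> card N \<le> d" if G: "is_face q n d G" and BG: "B \<subseteq> G" for d G
  proof -
    obtain I c where I: "d \<le> n" "I \<subseteq> {..<n}" "card I = n - d" 
        and G_eq: "G = {x \<in> qcube q n. \<forall>i\<in>I. x i = c i}"
      using G unfolding is_face_def by blast
    have const: "x i = c i" if "x \<in> B" "i \<in> I" for x i using that BG G_eq by blast
    have "x i = y i" if "x \<in> B" "y \<in> B" "i \<in> I" for x y i
      using const[OF that(1,3)] const[OF that(2,3)] by simp
    then have IC: "I \<subseteq> C" using I(2) by (force simp: C_def N_def varying_def)
    have "card I \<le> card C" by (rule card_mono[OF _ IC]) (simp add: C_def)
    then have "card N \<le> d" using I(1,3) cC cN by linarith
    moreover have "F \<subseteq> G" using IC const[OF b] by (auto simp: F_def G_eq)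
    ultimately show ?thesis by blast
  qed
  show ?thesis using face sub least unfolding N_def by blast
qed

lemma face_rank_eq_card_varying:
  assumes "B \<noteq> {}" and "B \<subseteq> qcube q n"
  shows "face_rank q n B = card (varying n B)"
  unfolding face_rank_def
  by (rule Least_equality) (use face_rank_smallest[OF assms] in blast)+

end

theory Submission
  imports Defs
begin

text \<open>Both sides count the pairs \<open>(F, B)\<close> of a \<open>k\<close>-dimensional face \<open>F\<close> and an \<open>s\<close>-element
  set \<open>B \<subseteq> F \<inter> A\<close>. For fixed \<open>F\<close> there are \<open>card (F \<inter> A) choose s\<close> choices of \<open>B\<close>. For fixed \<open>B\<close>
  of rank \<open>r\<close>, the faces containing \<open>B\<close> are obtained by freezing \<open>n - k\<close> of the \<open>n - r\<close> coordinates
  that are constant on \<open>B\<close>.\<close>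

lemma finite_qcube: "finite (qcube q n)"
  by (simp add: qcube_def finite_PiE)

lemma finite_faces: "finite {F. is_face q n k F}"
  by (rule finite_subset[of _ "Pow (qcube q n)"]) (auto simp: is_face_def finite_qcube)

text \<open>A vector of a face is determined by its \<open>k\<close> free coordinates, so
  restriction to them is injective. The bound shows that cutting the sum over \<open>e\<close> off
  at \<open>q ^ k\<close> loses no face.\<close>

lemma card_face_le:
  assumes "is_face q n k F"
  shows "card F \<le> q ^ k"
proof -
  obtain I c where "k \<le> n" and I: "I \<subseteq> {..<n}" "card I = n - k"
      and F: "F = {x \<in> qcube q n. \<forall>i\<in>I. x i = c i}"
    using assms unfolding is_face_def by blast
  have card_free: "card ({..<n} - I) = k"
    using card_Diff_subset[of I "{..<n}"] I \<open>k \<le> n\<close> finite_subset[OF I(1)] by simp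
  have "inj_on (\<lambda>x. restrict x ({..<n} - I)) F"
  proof (rule inj_onI)
    fix x y
    assume "x \<in> F" "y \<in> F" and eq: "restrict x ({..<n} - I) = restrict y ({..<n} - I)"
    then have xy: "x \<in> {..<n} \<rightarrow>\<^sub>E {..<q}" "y \<in> {..<n} \<rightarrow>\<^sub>E {..<q}" "\<forall>i\<in>I. x i = y i"
      by (auto simp: F qcube_def)
    have "x i = y i" if "i < n" for i
      using xy(3) fun_cong[OF eq, of i] that by (cases "i \<in> I") auto
    then show "x = y" using xy(1,2) by (intro PiE_ext) auto
  qed
  moreover have "(\<lambda>x. restrict x ({..<n} - I)) ` F \<subseteq> ({..<n} - I) \<rightarrow>\<^sub>E {..<q}"
    by (auto simp: F qcube_def)
  ultimately have "card F \<le> card (({..<n} - I) \<rightarrow>\<^sub>E {..<q})"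
    by (intro card_inj_on_le) (auto simp: finite_PiE)
  then show ?thesis by (simp add: card_PiE card_free)
qed

text \<open>Changing a single coordinate outside \<open>I\<close> stays inside the first face, so
  the second cannot freeze that coordinate. Consequently different sets of frozen coordinates give
  different faces through \<open>b\<close>.\<close>

lemma face_subset_imp_subset:
  assumes "q \<ge> 2" and b: "b \<in> qcube q n" and "J \<subseteq> {..<n}"
    and sub: "{x \<in> qcube q n. \<forall>i\<in>I. x i = b i} \<subseteq> {x \<in> qcube q n. \<forall>i\<in>J. x i = b i}"
  shows "J \<subseteq> I"
proof
  fix j assume "j \<in> J"
  show "j \<in> I"
  proof (rule ccontr)
    assume "j \<notin> I"
    \<comment> \<open>The other value for coordinate \<open>j\<close> is taken from 0 and 1, both of
      which are below \<open>q\<close> because \<open>q \<ge> 2\<close>.\<close>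
    define x where "x = b(j := if b j = 0 then 1 else 0)"
    have "j < n" using \<open>j \<in> J\<close> assms(3) by blast
    then have "x \<in> qcube q n"
      using b \<open>q \<ge> 2\<close> by (auto simp: x_def qcube_def PiE_iff extensional_def)
    moreover have "\<forall>i\<in>I. x i = b i" using \<open>j \<notin> I\<close> by (auto simp: x_def)
    ultimately have "x j = b j" using sub \<open>j \<in> J\<close> by blast
    then show False by (simp add: x_def split: if_splits)
  qed
qed

lemma card_faces_containing:
  assumes "q \<ge> 2" and "B \<noteq> {}" and B: "B \<subseteq> qcube q n" and "k \<le> n"
  shows "card {F. is_face q n k F \<and> B \<subseteq> F} =
         binom (n - face_rank q n B) (int k - int (face_rank q n B))"
proof -
  obtain b where b: "b \<in> B" using \<open>B \<noteq> {}\<close> by blast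
  then have bq: "b \<in> qcube q n" using B by blast
  define C where "C = {..<n} - varying n B"
  \<comment> \<open>A face containing \<open>B\<close> contains \<open>b\<close>, so its prescribed
    values can be read off from \<open>b\<close> and only the set \<open>I\<close> remains to be
    chosen.\<close>
  define face where "face I = {x \<in> qcube q n. \<forall>i\<in>I. x i = b i}" for I
  define r where "r = face_rank q n B"
  have r: "r = card (varying n B)"
    unfolding r_def using face_rank_eq_card_varying assms(2,3) .
  have V: "varying n B \<subseteq> {..<n}" by (auto simp: varying_def)
  then have "r \<le> n" unfolding r using card_mono[OF _ V] by simp
  have cC: "card C = n - r"
    unfolding r C_def using card_Diff_subset[OF finite_subset[OF V] V] by simp
  have "{F. is_face q n k F \<and> B \<subseteq> F} = face ` {I. I \<subseteq> C \<and> card I = n - k}"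
  proof (intro equalityI subsetI)
    fix F assume "F \<in> {F. is_face q n k F \<and> B \<subseteq> F}"
    then obtain I c where I: "I \<subseteq> {..<n}" "card I = n - k"
        and F: "F = {x \<in> qcube q n. \<forall>i\<in>I. x i = c i}" and BF: "B \<subseteq> F"
      unfolding is_face_def by blast
    \<comment> \<open>All of \<open>B\<close> takes the value \<open>c i\<close> at a frozen
      coordinate \<open>i\<close>; hence \<open>i\<close> is constant on \<open>B\<close> and
      \<open>c i = b i\<close>.\<close>
    have const: "x i = c i" if "x \<in> B" "i \<in> I" for x i using that BF F by blast
    have "x i = y i" if "x \<in> B" "y \<in> B" "i \<in> I" for x y i
      using const[OF that(1,3)] const[OF that(2,3)] by simp
    then have "I \<subseteq> C" using I(1) by (force simp: C_def varying_def)
    moreover have "F = face I" using const[OF b] by (auto simp: F face_def)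
    ultimately show "F \<in> face ` {I. I \<subseteq> C \<and> card I = n - k}" using I(2) by blast
  next
    fix F assume "F \<in> face ` {I. I \<subseteq> C \<and> card I = n - k}"
    then obtain I where I: "I \<subseteq> C" "card I = n - k" "F = face I" by blast
    have "is_face q n k F"
      unfolding is_face_def using I bq \<open>k \<le> n\<close> by (auto simp: C_def face_def)
    moreover have "B \<subseteq> F" using I(1) b B by (auto simp: I(3) face_def C_def varying_def)
    ultimately show "F \<in> {F. is_face q n k F \<and> B \<subseteq> F}" by blast
  qed
  moreover have "inj_on face {I. I \<subseteq> C \<and> card I = n - k}"
  proof (rule inj_onI)
    fix I J
    assume "I \<in> {I. I \<subseteq> C \<and> card I = n - k}" "J \<in> {I. I \<subseteq> C \<and> card I = n - k}"
      and eq: "face I = face J"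
    then have "I \<subseteq> {..<n}" "J \<subseteq> {..<n}" by (auto simp: C_def)
    then show "I = J"
      using face_subset_imp_subset[OF \<open>q \<ge> 2\<close> bq, of I J]
        face_subset_imp_subset[OF \<open>q \<ge> 2\<close> bq, of J I] eq
      unfolding face_def by blast
  qed
  ultimately have "card {F. is_face q n k F \<and> B \<subseteq> F} = (n - r) choose (n - k)"
    using n_subsets[of C "n - k"] by (simp add: card_image cC) (simp add: C_def)
  also have "\<dots> = binom (n - r) (int k - int r)"
  \<comment> \<open>If \<open>k < r\<close>, both sides are 0: on the left \<open>n - k\<close>
    exceeds \<open>n - r\<close>, on the right the lower index is negative. Otherwise this is the
    symmetry of binomial coefficients.\<close>
  proof (cases "k < r")
    case True
    then show ?thesis using \<open>r \<le> n\<close> by (simp add: binom_def)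
  next
    case False
    then have "nat (int k - int r) = n - r - (n - k)" and "n - k \<le> n - r"
      using \<open>k \<le> n\<close> by linarith+
    then show ?thesis using False binomial_symmetric[of "n - k" "n - r"]
      by (simp add: binom_def)
  qed
  finally show ?thesis unfolding r_def .
qed

theorem theorem2:
  fixes q n k s :: nat and A :: "(nat \<Rightarrow> nat) set"
  assumes "q \<ge> 2" and "n \<ge> 1"
    and "A \<subseteq> qcube q n" and "A \<noteq> {}"
    and "k \<le> n"
    and "1 \<le> s" and "s \<le> min (card A) (q ^ k)"
  shows "(\<Sum>e = s..min (card A) (q ^ k). (e choose s) * num_faces q n A k e) =
         (\<Sum>B | B \<subseteq> A \<and> card B = s.
            binom (n - face_rank q n B) (int k - int (face_rank q n B)))"
proof -
  let ?p = "min (card A) (q ^ k)"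
  let ?Fs = "{F. is_face q n k F}"
  let ?Bs = "{B. B \<subseteq> A \<and> card B = s}"
  have finA: "finite A" using assms(3) finite_qcube finite_subset by blast
  have card_le: "card (F \<inter> A) \<le> ?p" if "is_face q n k F" for F
  proof -
    have "F \<subseteq> qcube q n" using that by (auto simp: is_face_def)
    then have "card (F \<inter> A) \<le> card F"
      using finite_subset[OF _ finite_qcube] by (intro card_mono) auto
    then show ?thesis using card_face_le[OF that] card_mono[OF finA, of "F \<inter> A"] by simp
  qed
  \<comment> \<open>The added terms with \<open>e < s\<close> vanish. The range now starts at 0, so
    that every face has its intersection size in it.\<close>
  have "(\<Sum>e = s..?p. (e choose s) * num_faces q n A k e) =
        (\<Sum>e = 0..?p. (e choose s) * num_faces q n A k e)"
    by (rule sum.mono_neutral_left) auto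
  also have "\<dots> = (\<Sum>e = 0..?p. \<Sum>F \<in> {F \<in> ?Fs. card (F \<inter> A) = e}. card (F \<inter> A) choose s)"
    by (rule sum.cong) (simp_all add: num_faces_def)
  \<comment> \<open>The faces are partitioned by the size of \<open>F \<inter> A\<close>, which
    \<open>card_le\<close> keeps within the range.\<close>
  also have "\<dots> = (\<Sum>F \<in> ?Fs. card (F \<inter> A) choose s)"
    by (rule sum.group) (use card_le in \<open>auto simp: finite_faces\<close>)
  also have "\<dots> = (\<Sum>F \<in> ?Fs. \<Sum>B \<in> {B \<in> ?Bs. B \<subseteq> F}. 1)"
  proof (rule sum.cong)
    fix F
    have "{B \<in> ?Bs. B \<subseteq> F} = {B. B \<subseteq> F \<inter> A \<and> card B = s}" by blast
    then show "card (F \<inter> A) choose s = (\<Sum>B \<in> {B \<in> ?Bs. B \<subseteq> F}. 1)"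
      using n_subsets[of "F \<inter> A" s] finA by simp
  qed simp
  also have "\<dots> = (\<Sum>B \<in> ?Bs. \<Sum>F \<in> {F \<in> ?Fs. B \<subseteq> F}. 1)"
    by (rule sum.swap_restrict) (simp_all add: finite_faces finA)
  also have "\<dots> = (\<Sum>B \<in> ?Bs. binom (n - face_rank q n B) (int k - int (face_rank q n B)))"
  proof (rule sum.cong)
    fix B assume "B \<in> ?Bs"
    \<comment> \<open>Non-emptiness comes from \<open>1 \<le> s\<close>.\<close>
    then have "B \<noteq> {}" "B \<subseteq> qcube q n" using assms(3,6) by auto
    then show "(\<Sum>F \<in> {F \<in> ?Fs. B \<subseteq> F}. 1) =
        binom (n - face_rank q n B) (int k - int (face_rank q n B))"
      using card_faces_containing[OF \<open>q \<ge> 2\<close> _ _ \<open>k \<le> n\<close>] by simp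
  qed simp
  finally show ?thesis .
qed

end
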